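(* Let $\Gamma$ be a graph, let $G\le \mathrm{Aut}(\Gamma)$ and let $\mathcal{T}$ be a connected transversal of $G$ on $\Gamma$. Let $\mathcal{T}_V=\mathcal{T}\cap V(\Gamma)$, $\mathcal{T}_D=\mathcal{T}\cap D(\Gamma)$ and $\mathcal{T}_D^\circ=\{x\in\mathcal{T}_D : x^{-1}\in\mathcal{T}_D\}$. For each dart $x\in \mathcal{T}_D\setminus \mathcal{T}_D^\circ$ let $a_x\in G$ be such that $(x^{-1})^{a_x} \in \mathcal{T}_D$. Then $\Gamma$ is connected if and only if $$G=\Big\langle \bigcup_{v \in \mathcal{T}_V} G_v\, \cup\, \{a_x : x \in \mathcal{T}_D\setminus \mathcal{T}_D^\circ \}\Big\rangle.$$
   Context: A graph is a quadruple $(V,D,\mathrm{beg},\mathrm{inv})$ where $V$ is a non-empty set of vertices, $D$ is a set of darts (disjoint from $V$), $\mathrm{beg}\colon D\to V$, and $\mathrm{inv}\colon D\to D$ satisfies $\mathrm{inv}\,\mathrm{inv}\,x=x$ for all $x\in D$. For $\Gamma=(V,D,\mathrm{beg},\mathrm{inv})$ write $V(\Gamma)=V$, $D(\Gamma)=D$, $\mathrm{beg}_\Gamma=\mathrm{beg}$, $\mathrm{inv}_\Gamma=\mathrm{inv}$; also $x^{-1}:=\mathrm{inv}\,x$ and $\mathrm{end}\,x:=\mathrm{beg}\,x^{-1}$. A walk is a sequence of darts $(x_1,\dots,x_n)$ with $\mathrm{end}\,x_i=\mathrm{beg}\,x_{i+1}$; a walk of length $0$ is regarded as a walk from any vertex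 to itself. A graph is connected if for any two vertices $u,v$ there is a walk from $u$ to $v$. An automorphism of $\Gamma$ is a permutation of $V(\Gamma)\cup D(\Gamma)$ preserving $V(\Gamma)$ and $D(\Gamma)$ and commuting with $\mathrm{beg}$ and $\mathrm{inv}$; $\mathrm{Aut}(\Gamma)$ acts on the right, with the image of $x$ under $g$ denoted $x^g$. $G_v$ is the stabiliser of $v$ in $G$. Connected transversals. Let $G\le\mathrm{Aut}(\Gamma)$ and let $\mathcal{T}$ be a transversal of the action of $G$ on $V(\Gamma)\cup D(\Gamma)$, i.e. a subset containing precisely one element of each $G$-orbit. With $\mathcal{T}_V=\mathcal{T}\cap V(\Gamma)$, $\mathcal{T}_D=\mathcal{T}\cap D(\Gamma)$, $\mathcal{T}_D^\circ=\{x\in\mathcal{T}_D : x^{-1}\in\mathcal{T}_D\}$, $\mathcal{T}$ is a connected transversal of $G$ on $\Gamma$ if (1) $\mathrm{beg}_\Gamma x\in\mathcal{T}_V$ for every $x\in\mathcal{T}_D$; and (2) the graph $\Gamma[\mathcal{T}]$ with vertex set $\mathcal{T}_V$, dart set $\mathcal{T}_D^\circ$, and $\mathrm{beg}$, $\mathrm{inv}$ the restrictions of $\mathrm{beg}_\Gamma$, $\mathrm{inv}_\Gamma$ to $\mathcal{T}_D^\circ$, is connected. *)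

theory Defs
  imports "HOL-Algebra.Algebra"
begin

record 'a graph =
  verts :: "'a set"
  darts :: "'a set"
  beg :: "'a \<Rightarrow> 'a"
  dinv :: "'a \<Rightarrow> 'a"

text \<open>
  Vertices and darts live in one type, so that automorphisms are permutations of their union.
  Only the values of \<^term>\<open>beg \<Gamma>\<close> and \<^term>\<open>dinv \<Gamma>\<close> on darts matter.
  Darts fixed by \<^term>\<open>dinv \<Gamma>\<close>, loops, parallel darts and infinite graphs are all allowed.
\<close>

definition is_graph :: "'a graph \<Rightarrow> bool" where
  "is_graph \<Gamma> \<longleftrightarrow>
     verts \<Gamma> \<noteq> {} \<and> verts \<Gamma> \<inter> darts \<Gamma> = {} \<and>
     beg \<Gamma> \<in> darts \<Gamma> \<rightarrow> verts \<Gamma> \<and> dinv \<Gamma> \<in> darts \<Gamma> \<rightarrow> darts \<Gamma> \<and>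
     (\<forall>x \<in> darts \<Gamma>. dinv \<Gamma> (dinv \<Gamma> x) = x)"

definition dend :: "'a graph \<Rightarrow> 'a \<Rightarrow> 'a" where
  "dend \<Gamma> x = beg \<Gamma> (dinv \<Gamma> x)"

definition is_walk :: "'a graph \<Rightarrow> 'a list \<Rightarrow> bool" where
  "is_walk \<Gamma> xs \<longleftrightarrow>
     set xs \<subseteq> darts \<Gamma> \<and>
     (\<forall>i. Suc i < length xs \<longrightarrow> dend \<Gamma> (xs ! i) = beg \<Gamma> (xs ! Suc i))"

definition walk_between :: "'a graph \<Rightarrow> 'a \<Rightarrow> 'a list \<Rightarrow> 'a \<Rightarrow> bool" where
  "walk_between \<Gamma> u xs v \<longleftrightarrow>
     is_walk \<Gamma> xs \<and>
     (if xs = [] then u = v else beg \<Gamma> (hd xs) = u \<and> dend \<Gamma> (last xs) = v)"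

definition graph_connected :: "'a graph \<Rightarrow> bool" where
  "graph_connected \<Gamma> \<longleftrightarrow> (\<forall>u \<in> verts \<Gamma>. \<forall>v \<in> verts \<Gamma>. \<exists>xs. walk_between \<Gamma> u xs v)"

definition is_aut :: "'a graph \<Rightarrow> ('a \<Rightarrow> 'a) \<Rightarrow> bool" where
  "is_aut \<Gamma> g \<longleftrightarrow>
     g permutes (verts \<Gamma> \<union> darts \<Gamma>) \<and> g ` verts \<Gamma> = verts \<Gamma> \<and> g ` darts \<Gamma> = darts \<Gamma> \<and>
     (\<forall>x \<in> darts \<Gamma>. g (beg \<Gamma> x) = beg \<Gamma> (g x) \<and> g (dinv \<Gamma> x) = dinv \<Gamma> (g x))"

text \<open>
  Automorphisms act on the right: the image of \<open>x\<close> under \<open>g\<close> is \<open>g x\<close>, and in a product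
  \<open>g \<otimes> h\<close> the factor \<open>g\<close> is applied first.
\<close>

definition aut_group :: "'a graph \<Rightarrow> ('a \<Rightarrow> 'a) monoid" where
  "aut_group \<Gamma> = \<lparr>carrier = {g. is_aut \<Gamma> g}, monoid.mult = (\<lambda>g h. h \<circ> g), one = id\<rparr>"

abbreviation aut_subgroup :: "'a graph \<Rightarrow> ('a \<Rightarrow> 'a) set \<Rightarrow> ('a \<Rightarrow> 'a) monoid" where
  "aut_subgroup \<Gamma> G \<equiv> (aut_group \<Gamma>)\<lparr>carrier := G\<rparr>"

text \<open>
  The constants \<^const>\<open>orbits\<close> and \<^const>\<open>stabilizer\<close> use only the carrier of the acting
  group and the evaluation map, so they do not depend on the side from which the group acts.
\<close>

definition is_transversal :: "'a graph \<Rightarrow> ('a \<Rightarrow> 'a) set \<Rightarrow> 'a set \<Rightarrow> bool" where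
  "is_transversal \<Gamma> G T \<longleftrightarrow>
     T \<subseteq> verts \<Gamma> \<union> darts \<Gamma> \<and>
     (\<forall>B \<in> orbits (aut_subgroup \<Gamma> G) (verts \<Gamma> \<union> darts \<Gamma>) (\<lambda>g x. g x). \<exists>!t. t \<in> T \<inter> B)"

definition trans_verts :: "'a graph \<Rightarrow> 'a set \<Rightarrow> 'a set" where
  "trans_verts \<Gamma> T = T \<inter> verts \<Gamma>"

definition trans_darts :: "'a graph \<Rightarrow> 'a set \<Rightarrow> 'a set" where
  "trans_darts \<Gamma> T = T \<inter> darts \<Gamma>"

definition trans_inner_darts :: "'a graph \<Rightarrow> 'a set \<Rightarrow> 'a set" where
  "trans_inner_darts \<Gamma> T = {x \<in> trans_darts \<Gamma> T. dinv \<Gamma> x \<in> trans_darts \<Gamma> T}"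

definition trans_graph :: "'a graph \<Rightarrow> 'a set \<Rightarrow> 'a graph" where
  "trans_graph \<Gamma> T =
     \<lparr>verts = trans_verts \<Gamma> T, darts = trans_inner_darts \<Gamma> T,
      beg = restrict (beg \<Gamma>) (trans_inner_darts \<Gamma> T),
      dinv = restrict (dinv \<Gamma>) (trans_inner_darts \<Gamma> T)\<rparr>"

definition connected_transversal :: "'a graph \<Rightarrow> ('a \<Rightarrow> 'a) set \<Rightarrow> 'a set \<Rightarrow> bool" where
  "connected_transversal \<Gamma> G T \<longleftrightarrow>
     is_transversal \<Gamma> G T \<and>
     (\<forall>x \<in> trans_darts \<Gamma> T. beg \<Gamma> x \<in> trans_verts \<Gamma> T) \<and>
     graph_connected (trans_graph \<Gamma> T)"

lemma is_aut_inv: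
  assumes "is_graph \<Gamma>" and g: "is_aut \<Gamma> g"
  shows "is_aut \<Gamma> (inv_into UNIV g)"
proof -
  let ?h = "inv_into UNIV g"
  have p: "g permutes (verts \<Gamma> \<union> darts \<Gamma>)" using g by (simp add: is_aut_def)
  have b: "inj g" using p by (rule permutes_inj)
  have hg: "?h (g y) = y" for y using b by simp
  have gh: "g (?h y) = y" for y using p by (rule permutes_inverses)
  have V: "g ` verts \<Gamma> = verts \<Gamma>" and D: "g ` darts \<Gamma> = darts \<Gamma>" using g by (auto simp: is_aut_def)
  have V': "?h ` verts \<Gamma> = verts \<Gamma>" using V b by (metis image_inv_f_f)
  have D': "?h ` darts \<Gamma> = darts \<Gamma>" using D b by (metis image_inv_f_f)
  have "?h (beg \<Gamma> x) = beg \<Gamma> (?h x) \<and> ?h (dinv \<Gamma> x) = dinv \<Gamma> (?h x)" if "x \<in> darts \<Gamma>" for x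
  proof -
    have "?h x \<in> darts \<Gamma>" using that D' by blast
    then have "g (beg \<Gamma> (?h x)) = beg \<Gamma> x" "g (dinv \<Gamma> (?h x)) = dinv \<Gamma> x"
      using g gh by (auto simp: is_aut_def)
    then show ?thesis using hg by metis
  qed
  then show ?thesis using permutes_inv[OF p] V' D' by (simp add: is_aut_def)
qed

lemma group_aut_group:
  assumes "is_graph \<Gamma>"
  shows "group (aut_group \<Gamma>)"
proof (rule groupI)
  fix g h assume "g \<in> carrier (aut_group \<Gamma>)" "h \<in> carrier (aut_group \<Gamma>)"
  then have g: "is_aut \<Gamma> g" and h: "is_aut \<Gamma> h" by (auto simp: aut_group_def)
  have "h \<circ> g permutes (verts \<Gamma> \<union> darts \<Gamma>)"
    using g h by (auto simp: is_aut_def intro: permutes_compose)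
  moreover have "(h \<circ> g) ` verts \<Gamma> = verts \<Gamma>" "(h \<circ> g) ` darts \<Gamma> = darts \<Gamma>"
    using g h unfolding is_aut_def by (metis image_comp)+
  moreover have "\<forall>x \<in> darts \<Gamma>. (h \<circ> g) (beg \<Gamma> x) = beg \<Gamma> ((h \<circ> g) x) \<and>
      (h \<circ> g) (dinv \<Gamma> x) = dinv \<Gamma> ((h \<circ> g) x)"
    using g h by (auto simp: is_aut_def)
  ultimately show "g \<otimes>\<^bsub>aut_group \<Gamma>\<^esub> h \<in> carrier (aut_group \<Gamma>)"
    by (simp add: aut_group_def is_aut_def)
next
  fix g assume "g \<in> carrier (aut_group \<Gamma>)"
  then have g: "is_aut \<Gamma> g" by (simp add: aut_group_def)
  then have "inv_into UNIV g \<otimes>\<^bsub>aut_group \<Gamma>\<^esub> g = \<one>\<^bsub>aut_group \<Gamma>\<^esub>"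
    by (auto simp: aut_group_def is_aut_def permutes_inv_o)
  then show "\<exists>h \<in> carrier (aut_group \<Gamma>). h \<otimes>\<^bsub>aut_group \<Gamma>\<^esub> g = \<one>\<^bsub>aut_group \<Gamma>\<^esub>"
    using is_aut_inv[OF assms g] by (auto simp: aut_group_def)
qed (auto simp: aut_group_def is_aut_def comp_assoc permutes_id)

end

theory Submission
  imports Defs
begin

text \<open>
  Both directions rest on comparing reachability in \<open>\<Gamma>\<close> with the subgroup \<open>H\<close> generated by the
  stabilisers and the elements \<open>a\<^sub>x\<close>. The vertices of \<open>T\<close> lie in one component. The elements of
  \<open>G\<close> that send each vertex of \<open>T\<close> into that component form a subgroup containing the
  generators; so if \<open>H = G\<close>, every vertex lies in it, because \<open>T\<close> meets every orbit. Conversely,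
  the union of the \<open>H\<close>-translates of the vertices of \<open>T\<close> is closed under adjacency, so if \<open>\<Gamma>\<close> is
  connected it contains every vertex, and for \<open>g \<in> G\<close> and a vertex \<open>t\<close> of \<open>T\<close> we get
  \<open>g t = h t\<close> with \<open>h \<in> H\<close>, whence \<open>g \<in> H\<close> since \<open>H\<close> contains the stabiliser of \<open>t\<close>.
\<close>

section \<open>Walks and the reachability relation\<close>

definition adj :: "'a graph \<Rightarrow> ('a \<times> 'a) set" where
  "adj \<Gamma> = {(beg \<Gamma> x, dend \<Gamma> x) | x. x \<in> darts \<Gamma>}"

lemma adjI: "x \<in> darts \<Gamma> \<Longrightarrow> (beg \<Gamma> x, dend \<Gamma> x) \<in> adj \<Gamma>"
  by (auto simp: adj_def)

lemma is_walk_Cons: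
  "is_walk \<Gamma> (x # xs) \<longleftrightarrow>
     x \<in> darts \<Gamma> \<and> is_walk \<Gamma> xs \<and> (xs \<noteq> [] \<longrightarrow> dend \<Gamma> x = beg \<Gamma> (hd xs))"
proof -
  have "(\<forall>i. Suc i < length (x # xs) \<longrightarrow> dend \<Gamma> ((x # xs) ! i) = beg \<Gamma> ((x # xs) ! Suc i)) \<longleftrightarrow>
      (xs \<noteq> [] \<longrightarrow> dend \<Gamma> x = beg \<Gamma> (hd xs)) \<and>
      (\<forall>i. Suc i < length xs \<longrightarrow> dend \<Gamma> (xs ! i) = beg \<Gamma> (xs ! Suc i))"
  proof -
    \<comment> \<open>Index 0 carries the junction between \<open>x\<close> and
      \<open>hd xs\<close>; the shifted indices are the junctions inside \<open>xs\<close>.\<close>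
    have split: "(\<forall>i. P i) \<longleftrightarrow> P 0 \<and> (\<forall>i. P (Suc i))" for P :: "nat \<Rightarrow> bool"
      by (metis not0_implies_Suc)
    show ?thesis
      by (subst split) (simp add: hd_conv_nth)
  qed
  then show ?thesis by (auto simp: is_walk_def)
qed

lemma walk_between_Nil: "walk_between \<Gamma> u [] v \<longleftrightarrow> u = v"
  by (simp add: walk_between_def is_walk_def)

lemma walk_between_Cons:
  "walk_between \<Gamma> u (x # xs) v \<longleftrightarrow>
     x \<in> darts \<Gamma> \<and> beg \<Gamma> x = u \<and> walk_between \<Gamma> (dend \<Gamma> x) xs v"
  by (auto simp: walk_between_def is_walk_Cons)

text \<open>Working with a closure instead of dart lists supplies transitivity and induction along
  paths. Both directions remove or add the first dart, matching \<open>walk_between_Cons\<close>;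
  the empty walk is the reflexive case.\<close>

lemma ex_walk_iff_rtrancl_adj:
  "(\<exists>xs. walk_between \<Gamma> u xs v) \<longleftrightarrow> (u, v) \<in> (adj \<Gamma>)\<^sup>*"
proof
  assume "\<exists>xs. walk_between \<Gamma> u xs v"
  then obtain xs where "walk_between \<Gamma> u xs v" ..
  then show "(u, v) \<in> (adj \<Gamma>)\<^sup>*"
  proof (induction xs arbitrary: u)
    case Nil
    then show ?case by (simp add: walk_between_Nil)
  next
    case (Cons x xs)
    then have x: "x \<in> darts \<Gamma>" "beg \<Gamma> x = u" "walk_between \<Gamma> (dend \<Gamma> x) xs v"
      by (simp_all add: walk_between_Cons)
    then have "(u, dend \<Gamma> x) \<in> adj \<Gamma>" using adjI[OF x(1)] x(2) by simp
    then show ?case using Cons.IH[OF x(3)] by (rule converse_rtrancl_into_rtrancl)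
  qed
next
  assume "(u, v) \<in> (adj \<Gamma>)\<^sup>*"
  then show "\<exists>xs. walk_between \<Gamma> u xs v"
  proof (induction rule: converse_rtrancl_induct)
    case base
    have "walk_between \<Gamma> v [] v" by (simp add: walk_between_Nil)
    then show ?case ..
  next
    case (step u w)
    obtain xs where xs: "walk_between \<Gamma> w xs v" using step.IH ..
    obtain x where "x \<in> darts \<Gamma>" "u = beg \<Gamma> x" "w = dend \<Gamma> x"
      using step.hyps(1) by (auto simp: adj_def)
    then have "walk_between \<Gamma> u (x # xs) v" using xs by (simp add: walk_between_Cons)
    then show ?case ..
  qed
qed

lemma graph_connected_iff:
  "graph_connected \<Gamma> \<longleftrightarrow> (\<forall>u \<in> verts \<Gamma>. \<forall>v \<in> verts \<Gamma>. (u, v) \<in> (adj \<Gamma>)\<^sup>*)"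
  by (simp add: graph_connected_def ex_walk_iff_rtrancl_adj)

lemma dinv_in_darts:
  assumes "is_graph \<Gamma>" "x \<in> darts \<Gamma>"
  shows "dinv \<Gamma> x \<in> darts \<Gamma>"
  using assms by (auto simp: is_graph_def)

text \<open>The reversed dart \<open>dinv \<Gamma> x\<close> is the witness: as
  \<open>dinv \<Gamma>\<close> is an involution on darts, it ends where \<open>x\<close>
  begins.\<close>

lemma adj_sym:
  assumes "is_graph \<Gamma>" "(u, v) \<in> adj \<Gamma>"
  shows "(v, u) \<in> adj \<Gamma>"
proof -
  obtain x where x: "x \<in> darts \<Gamma>" "u = beg \<Gamma> x" "v = dend \<Gamma> x"
    using assms(2) by (auto simp: adj_def)
  have "dinv \<Gamma> (dinv \<Gamma> x) = x" using assms(1) x(1) by (simp add: is_graph_def)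
  then show ?thesis
    using adjI[OF dinv_in_darts[OF assms(1) x(1)]] x by (simp add: dend_def)
qed

lemma reach_sym:
  assumes "is_graph \<Gamma>" "(u, v) \<in> (adj \<Gamma>)\<^sup>*"
  shows "(v, u) \<in> (adj \<Gamma>)\<^sup>*"
proof -
  have "sym (adj \<Gamma>)" using adj_sym[OF assms(1)] by (rule symI)
  then show ?thesis using assms(2) by (metis sym_rtrancl symD)
qed

section \<open>Automorphisms and subgroups of the automorphism group\<close>

lemma aut_beg: "is_aut \<Gamma> g \<Longrightarrow> x \<in> darts \<Gamma> \<Longrightarrow> g (beg \<Gamma> x) = beg \<Gamma> (g x)"
  and aut_dinv: "is_aut \<Gamma> g \<Longrightarrow> x \<in> darts \<Gamma> \<Longrightarrow> g (dinv \<Gamma> x) = dinv \<Gamma> (g x)"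
  and aut_dart: "is_aut \<Gamma> g \<Longrightarrow> x \<in> darts \<Gamma> \<Longrightarrow> g x \<in> darts \<Gamma>"
  and aut_vert: "is_aut \<Gamma> g \<Longrightarrow> x \<in> verts \<Gamma> \<Longrightarrow> g x \<in> verts \<Gamma>"
  by (auto simp: is_aut_def)

lemma aut_dend:
  assumes "is_graph \<Gamma>" "is_aut \<Gamma> g" "x \<in> darts \<Gamma>"
  shows "g (dend \<Gamma> x) = dend \<Gamma> (g x)"
  using assms by (simp add: dend_def aut_beg aut_dinv dinv_in_darts)

lemma aut_bij: "is_aut \<Gamma> g \<Longrightarrow> bij g"
  by (auto simp: is_aut_def intro: permutes_bij)

lemma aut_reach:
  assumes "is_graph \<Gamma>" "is_aut \<Gamma> g" "(u, v) \<in> (adj \<Gamma>)\<^sup>*"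
  shows "(g u, g v) \<in> (adj \<Gamma>)\<^sup>*"
  using assms(3)
proof induction
  case (step v w)
  from step.hyps(2) obtain x where x: "x \<in> darts \<Gamma>" "v = beg \<Gamma> x" "w = dend \<Gamma> x"
    by (auto simp: adj_def)
  have "(g v, g w) \<in> adj \<Gamma>"
    using x assms(1,2) by (simp add: aut_beg aut_dend aut_dart adjI)
  then show ?case using step.IH by simp
qed simp

lemma aut_group_simps:
  "carrier (aut_group \<Gamma>) = {g. is_aut \<Gamma> g}"
  "g \<otimes>\<^bsub>aut_group \<Gamma>\<^esub> h = h \<circ> g"
  "\<one>\<^bsub>aut_group \<Gamma>\<^esub> = id"
  by (simp_all add: aut_group_def)

lemma inv_aut_group:
  assumes "is_graph \<Gamma>" "is_aut \<Gamma> g"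
  shows "inv\<^bsub>aut_group \<Gamma>\<^esub> g = inv_into UNIV g"
proof (rule group.inv_equality[OF group_aut_group[OF assms(1)]])
  \<comment> \<open>The left factor acts first, so this equation reads
    \<open>g \<circ> inv_into UNIV g = id\<close> and comes from surjectivity of
    \<open>g\<close>.\<close>
  show "inv_into UNIV g \<otimes>\<^bsub>aut_group \<Gamma>\<^esub> g = \<one>\<^bsub>aut_group \<Gamma>\<^esub>"
    using aut_bij[OF assms(2)] by (auto simp: aut_group_simps bij_is_surj surj_f_inv_f)
qed (use assms is_aut_inv in \<open>auto simp: aut_group_simps\<close>)

text \<open>The composite \<open>g \<circ> h\<close> is the group product
  \<open>h \<otimes> g\<close>, which is why the two membership assumptions are swapped in the
  proof.\<close>

lemma aut_subgroup_comp:
  assumes "subgroup H (aut_group \<Gamma>)" "g \<in> H" "h \<in> H"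
  shows "g \<circ> h \<in> H"
  using subgroup.m_closed[OF assms(1,3,2)] by (simp add: aut_group_simps)

lemma aut_subgroup_id:
  assumes "subgroup H (aut_group \<Gamma>)"
  shows "id \<in> H"
  using subgroup.one_closed[OF assms] by (simp add: aut_group_simps)

lemma aut_subgroup_aut:
  assumes "subgroup H (aut_group \<Gamma>)" "g \<in> H"
  shows "is_aut \<Gamma> g"
  using subgroup.mem_carrier[OF assms] by (simp add: aut_group_simps)

lemma aut_subgroup_inv:
  assumes "is_graph \<Gamma>" "subgroup H (aut_group \<Gamma>)" "g \<in> H"
  shows "inv_into UNIV g \<in> H"
  using subgroup.m_inv_closed[OF assms(2,3)] inv_aut_group[OF assms(1) aut_subgroup_aut[OF assms(2,3)]]
  by simp

lemma mem_stabilizer_iff: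
  "g \<in> stabilizer (aut_subgroup \<Gamma> G) (\<lambda>g x. g x) v \<longleftrightarrow> g \<in> G \<and> g v = v"
  by (simp add: stabilizer_def)

section \<open>Connected transversals and their generating set\<close>

locale connected_transversal_graph =
  fixes \<Gamma> :: "'a graph" and G :: "('a \<Rightarrow> 'a) set" and T :: "'a set"
    and a :: "'a \<Rightarrow> ('a \<Rightarrow> 'a)"
  assumes graph: "is_graph \<Gamma>"
    and subgroup_G: "subgroup G (aut_group \<Gamma>)"
    and transversal: "connected_transversal \<Gamma> G T"
    and return_elt: "\<And>x. x \<in> trans_darts \<Gamma> T - trans_inner_darts \<Gamma> T \<Longrightarrow>
           a x \<in> G \<and> a x (dinv \<Gamma> x) \<in> trans_darts \<Gamma> T"
begin

abbreviation "TV \<equiv> trans_verts \<Gamma> T"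
abbreviation "TD \<equiv> trans_darts \<Gamma> T"
abbreviation "TI \<equiv> trans_inner_darts \<Gamma> T"

definition gens :: "('a \<Rightarrow> 'a) set" where
  "gens = (\<Union>v \<in> TV. stabilizer (aut_subgroup \<Gamma> G) (\<lambda>g x. g x) v) \<union> {a x | x. x \<in> TD - TI}"

lemma gens_cases:
  assumes "g \<in> gens"
  obtains v where "v \<in> TV" "g \<in> G" "g v = v" | x where "x \<in> TD - TI" "g = a x"
  using assms by (auto simp: gens_def mem_stabilizer_iff)

lemma gens_stab: "v \<in> TV \<Longrightarrow> g \<in> G \<Longrightarrow> g v = v \<Longrightarrow> g \<in> gens"
  by (auto simp: gens_def mem_stabilizer_iff)

lemma gens_return: "x \<in> TD - TI \<Longrightarrow> a x \<in> gens"
  by (auto simp: gens_def)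

lemma gens_subset: "gens \<subseteq> G"
  using return_elt by (auto elim: gens_cases)

lemma subgroup_generate_gens: "subgroup (generate (aut_group \<Gamma>) gens) (aut_group \<Gamma>)"
  using group.generate_is_subgroup[OF group_aut_group[OF graph]] gens_subset
    subgroup.subset[OF subgroup_G] by blast

lemma generate_gens_subset: "generate (aut_group \<Gamma>) gens \<subseteq> G"
  using group.generate_subgroup_incl[OF group_aut_group[OF graph] gens_subset subgroup_G] .

lemmas aut_G = aut_subgroup_aut[OF subgroup_G]

section \<open>Orbit representatives and the ends of transversal darts\<close>

lemma ex_orbit_repr:
  assumes "x \<in> verts \<Gamma> \<union> darts \<Gamma>"
  shows "\<exists>g \<in> G. g x \<in> T"
proof -
  let ?B = "orbit (aut_subgroup \<Gamma> G) (\<lambda>g x. g x) x"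
  have "?B \<in> orbits (aut_subgroup \<Gamma> G) (verts \<Gamma> \<union> darts \<Gamma>) (\<lambda>g x. g x)"
    using assms by (auto simp: orbits_def)
  then have "\<exists>!t. t \<in> T \<inter> ?B"
    using transversal by (auto simp: connected_transversal_def is_transversal_def)
  then show ?thesis by (auto simp: orbit_def)
qed

text \<open>Both \<open>t\<close> and \<open>g t\<close> represent the orbit of \<open>t\<close>,
  and \<open>T\<close> meets that orbit only once. For a vertex \<open>t\<close>, an element of
  \<open>G\<close> moving \<open>t\<close> into \<open>T\<close> therefore lies in the stabiliser of
  \<open>t\<close>, hence in \<open>gens\<close>.\<close>

lemma orbit_repr_unique:
  assumes "t \<in> T" "g \<in> G" "g t \<in> T"
  shows "g t = t"
proof -
  let ?B = "orbit (aut_subgroup \<Gamma> G) (\<lambda>g x. g x) t"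
  have "t \<in> verts \<Gamma> \<union> darts \<Gamma>"
    using assms(1) transversal by (auto simp: connected_transversal_def is_transversal_def)
  then have "?B \<in> orbits (aut_subgroup \<Gamma> G) (verts \<Gamma> \<union> darts \<Gamma>) (\<lambda>g x. g x)"
    by (auto simp: orbits_def)
  then have "\<exists>!t. t \<in> T \<inter> ?B"
    using transversal by (auto simp: connected_transversal_def is_transversal_def)
  moreover have "g t \<in> ?B" using assms(2) by (auto simp: orbit_def)
  moreover have "t \<in> ?B"
    using aut_subgroup_id[OF subgroup_G] by (auto simp: orbit_def intro!: exI[of _ id])
  ultimately show ?thesis using assms by blast
qed

lemma ex_vert_repr:
  assumes "v \<in> verts \<Gamma>"
  shows "\<exists>g \<in> G. g v \<in> TV"
proof -
  obtain g where "g \<in> G" "g v \<in> T" using ex_orbit_repr assms by blast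
  moreover from this have "g v \<in> verts \<Gamma>" using aut_vert[OF aut_G assms] by simp
  ultimately show ?thesis by (auto simp: trans_verts_def)
qed

lemma ex_dart_repr:
  assumes "x \<in> darts \<Gamma>"
  shows "\<exists>g \<in> G. g x \<in> TD"
proof -
  obtain g where "g \<in> G" "g x \<in> T" using ex_orbit_repr assms by blast
  moreover from this have "g x \<in> darts \<Gamma>" using aut_dart[OF aut_G assms] by simp
  ultimately show ?thesis by (auto simp: trans_darts_def)
qed

lemma TV_nonempty: "TV \<noteq> {}"
  using graph ex_vert_repr by (fastforce simp: is_graph_def)

lemma beg_TD: "x \<in> TD \<Longrightarrow> beg \<Gamma> x \<in> TV"
  using transversal by (simp add: connected_transversal_def)

lemma TD_darts: "x \<in> TD \<Longrightarrow> x \<in> darts \<Gamma>"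
  by (simp add: trans_darts_def)

lemma dend_inner: "x \<in> TI \<Longrightarrow> dend \<Gamma> x \<in> TV"
  using beg_TD by (simp add: dend_def trans_inner_darts_def)

text \<open>The end of \<open>x\<close> is the beginning of its inverse dart, which
  \<open>a x\<close> carries into \<open>TD\<close>; darts of \<open>TD\<close> begin in
  \<open>TV\<close>.\<close>

lemma return_dend:
  assumes "x \<in> TD - TI"
  shows "a x (dend \<Gamma> x) \<in> TV"
proof -
  have "is_aut \<Gamma> (a x)" using return_elt[OF assms] aut_G by simp
  moreover have "dinv \<Gamma> x \<in> darts \<Gamma>" using assms dinv_in_darts[OF graph] TD_darts by simp
  ultimately have "a x (beg \<Gamma> (dinv \<Gamma> x)) = beg \<Gamma> (a x (dinv \<Gamma> x))" by (rule aut_beg)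
  then show ?thesis using beg_TD return_elt[OF assms] by (simp add: dend_def)
qed

section \<open>The component of the transversal vertices; generation implies connectedness\<close>

lemma adj_trans_graph: "adj (trans_graph \<Gamma> T) \<subseteq> adj \<Gamma>"
proof -
  have "(beg (trans_graph \<Gamma> T) x, dend (trans_graph \<Gamma> T) x) \<in> adj \<Gamma>" if x: "x \<in> TI" for x
  proof -
    have "x \<in> darts \<Gamma>" using x by (simp add: trans_inner_darts_def TD_darts)
    \<comment> \<open>In \<open>trans_graph \<Gamma> T\<close> the map \<open>beg\<close> is
      restricted to \<open>TI\<close>, so the end of \<open>x\<close> there agrees with its end in
      \<Gamma> only once the inverse dart is known to lie in \<open>TI\<close>.\<close>
    moreover from this have "dinv \<Gamma> x \<in> TI"
      using x graph by (simp add: trans_inner_darts_def is_graph_def)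
    ultimately show ?thesis using x adjI[of x \<Gamma>] by (simp add: trans_graph_def dend_def)
  qed
  then show ?thesis unfolding adj_def[of "trans_graph \<Gamma> T"] by (auto simp: trans_graph_def)
qed

lemma TV_reach:
  assumes "u \<in> TV" "v \<in> TV"
  shows "(u, v) \<in> (adj \<Gamma>)\<^sup>*"
proof -
  have "(u, v) \<in> (adj (trans_graph \<Gamma> T))\<^sup>*"
    using transversal assms
    by (simp add: connected_transversal_def graph_connected_iff) (simp add: trans_graph_def)
  then show ?thesis using rtrancl_mono[OF adj_trans_graph] by blast
qed

text \<open>By \<open>TV_reach\<close>, this is the setwise stabiliser in \<open>G\<close> of the
  connected component containing \<open>TV\<close>.\<close>

definition local_movers :: "('a \<Rightarrow> 'a) set" where
  "local_movers = {g \<in> G. \<forall>v \<in> TV. (v, g v) \<in> (adj \<Gamma>)\<^sup>*}"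

text \<open>One vertex \<open>u\<close> decides for all of \<open>TV\<close>: any \<open>v\<close>
  is joined to \<open>w\<close>, then to \<open>g u\<close>, then to \<open>g v\<close> by the image
  under \<open>g\<close> of a path from \<open>u\<close> to \<open>v\<close>.\<close>

lemma local_moversI:
  assumes "g \<in> G" "u \<in> TV" "w \<in> TV" "(w, g u) \<in> (adj \<Gamma>)\<^sup>*"
  shows "g \<in> local_movers"
proof -
  have "(v, g v) \<in> (adj \<Gamma>)\<^sup>*" if v: "v \<in> TV" for v
  proof -
    have "(g u, g v) \<in> (adj \<Gamma>)\<^sup>*"
      using aut_reach[OF graph aut_G[OF assms(1)] TV_reach[OF assms(2) v]] .
    then show ?thesis using TV_reach[OF v assms(3)] assms(4) by simp
  qed
  then show ?thesis using assms(1) by (simp add: local_movers_def)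
qed

lemma gens_local_movers: "gens \<subseteq> local_movers"
proof
  fix g assume "g \<in> gens"
  then show "g \<in> local_movers"
  proof (cases rule: gens_cases)
    case (1 v)
    then show ?thesis by (intro local_moversI[of g v v]) auto
  next
    case (2 x)
    have aG: "a x \<in> G" using return_elt[OF 2(1)] by simp
    \<comment> \<open>The criterion \<open>local_moversI\<close> is applied with
      \<open>u = beg \<Gamma> x\<close> and \<open>w = a x (dend \<Gamma> x)\<close>: the image of
      the reversed dart under \<open>a x\<close> joins \<open>w\<close> to
      \<open>a x u\<close>.\<close>
    have "(dend \<Gamma> x, beg \<Gamma> x) \<in> adj \<Gamma>"
      using adj_sym[OF graph adjI] TD_darts 2(1) by simp
    then have "(a x (dend \<Gamma> x), a x (beg \<Gamma> x)) \<in> (adj \<Gamma>)\<^sup>*"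
      using aut_reach[OF graph aut_G[OF aG]] by (simp add: r_into_rtrancl)
    then have "a x \<in> local_movers"
      using local_moversI[OF aG _ return_dend[OF 2(1)]] beg_TD[of x] 2(1) by simp
    then show ?thesis using 2(2) by simp
  qed
qed

lemma subgroup_local_movers: "subgroup local_movers (aut_group \<Gamma>)"
proof (rule group.subgroupI[OF group_aut_group[OF graph]])
  show "local_movers \<subseteq> carrier (aut_group \<Gamma>)"
    using subgroup.subset[OF subgroup_G] by (auto simp: local_movers_def)
  show "local_movers \<noteq> {}"
    using aut_subgroup_id[OF subgroup_G] by (auto simp: local_movers_def)
next
  fix g assume g: "g \<in> local_movers"
  then have gG: "g \<in> G" by (simp add: local_movers_def)
  let ?h = "inv_into UNIV g"
  have hG: "?h \<in> G" using aut_subgroup_inv[OF graph subgroup_G gG] .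
  have "(v, ?h v) \<in> (adj \<Gamma>)\<^sup>*" if "v \<in> TV" for v
  proof -
    \<comment> \<open>Applying the inverse to a path from \<open>v\<close> to \<open>g v\<close>
      gives a path from \<open>?h v\<close> to \<open>v\<close>, which is then reversed.\<close>
    have "(?h v, ?h (g v)) \<in> (adj \<Gamma>)\<^sup>*"
      using aut_reach[OF graph aut_G[OF hG]] g that by (simp add: local_movers_def)
    then show ?thesis
      using reach_sym[OF graph] aut_bij[OF aut_G[OF gG]] by (simp add: bij_is_inj)
  qed
  then show "inv\<^bsub>aut_group \<Gamma>\<^esub> g \<in> local_movers"
    using hG inv_aut_group[OF graph aut_G[OF gG]] by (simp add: local_movers_def)
next
  fix g h assume g: "g \<in> local_movers" and h: "h \<in> local_movers"
  then have G: "g \<in> G" "h \<in> G" by (simp_all add: local_movers_def)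
  have "(v, h (g v)) \<in> (adj \<Gamma>)\<^sup>*" if v: "v \<in> TV" for v
  proof -
    \<comment> \<open>The path from \<open>v\<close> to \<open>g v\<close>, translated by
      \<open>h\<close>, continues the path from \<open>v\<close> to \<open>h v\<close>.\<close>
    have "(h v, h (g v)) \<in> (adj \<Gamma>)\<^sup>*"
      using aut_reach[OF graph aut_G[OF G(2)]] g v by (simp add: local_movers_def)
    moreover have "(v, h v) \<in> (adj \<Gamma>)\<^sup>*" using h v by (simp add: local_movers_def)
    ultimately show ?thesis by simp
  qed
  then show "g \<otimes>\<^bsub>aut_group \<Gamma>\<^esub> h \<in> local_movers"
    using aut_subgroup_comp[OF subgroup_G G(2,1)] by (simp add: aut_group_simps local_movers_def)
qed

lemma graph_connected_if_generate:
  assumes "G = generate (aut_group \<Gamma>) gens"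
  shows "graph_connected \<Gamma>"
proof -
  have movers: "G \<subseteq> local_movers"
    using assms group.generate_subgroup_incl[OF group_aut_group[OF graph]
        gens_local_movers subgroup_local_movers] by simp
  obtain t where t: "t \<in> TV" using TV_nonempty by blast
  have reach: "(t, v) \<in> (adj \<Gamma>)\<^sup>*" if v: "v \<in> verts \<Gamma>" for v
  proof -
    obtain g where g: "g \<in> G" "g v \<in> TV" using ex_vert_repr[OF v] by blast
    let ?h = "inv_into UNIV g"
    \<comment> \<open>The vertex \<open>v\<close> is the image under \<open>?h\<close> of its
      representative \<open>g v\<close> in \<open>TV\<close>, so it lies in the same component as
      \<open>g v\<close>.\<close>
    have "?h \<in> local_movers" using movers aut_subgroup_inv[OF graph subgroup_G g(1)] by blast
    then have "(g v, ?h (g v)) \<in> (adj \<Gamma>)\<^sup>*" using g(2) by (simp add: local_movers_def)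
    then have "(g v, v) \<in> (adj \<Gamma>)\<^sup>*" using aut_bij[OF aut_G[OF g(1)]] by (simp add: bij_is_inj)
    then show ?thesis using TV_reach[OF t g(2)] by simp
  qed
  then show ?thesis
    unfolding graph_connected_iff using reach_sym[OF graph] by (blast intro: rtrancl_trans)
qed

section \<open>Connectedness implies generation\<close>

lemma translate_adj_closed:
  assumes h: "h \<in> generate (aut_group \<Gamma>) gens" and t: "t \<in> TV" and adj: "(h t, v) \<in> adj \<Gamma>"
  shows "\<exists>k \<in> generate (aut_group \<Gamma>) gens. \<exists>s \<in> TV. v = k s"
proof -
  let ?H = "generate (aut_group \<Gamma>) gens"
  note comp = aut_subgroup_comp[OF subgroup_generate_gens]
  note inv = aut_subgroup_inv[OF graph subgroup_generate_gens]
  have HG: "g \<in> G" if "g \<in> ?H" for g using generate_gens_subset that by blast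
  have inv_apply: "inv_into UNIV g (g x) = x" if "g \<in> G" for g x
    using aut_bij[OF aut_G[OF that]] by (simp add: bij_is_inj)
  obtain x where x: "x \<in> darts \<Gamma>" "h t = beg \<Gamma> x" "v = dend \<Gamma> x"
    using adj by (auto simp: adj_def)
  \<comment> \<open>Pulling \<open>x\<close> back by \<open>h\<close> gives a dart beginning at
    \<open>t\<close>, which is next moved by some \<open>g\<close> to its representative
    \<open>y\<close> in \<open>TD\<close>.\<close>
  let ?h' = "inv_into UNIV h"
  have h': "?h' \<in> ?H" using inv[OF h] .
  have x': "?h' x \<in> darts \<Gamma>" using aut_dart[OF aut_G[OF HG[OF h']] x(1)] .
  have beg_x': "beg \<Gamma> (?h' x) = t"
    using aut_beg[OF aut_G[OF HG[OF h']] x(1)] x(2) inv_apply[OF HG[OF h]] by metis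
  obtain g where g: "g \<in> G" "g (?h' x) \<in> TD" using ex_dart_repr[OF x'] by blast
  define y where "y = g (?h' x)"
  have y: "y \<in> TD" using g(2) by (simp add: y_def)
  have "g t = beg \<Gamma> y" using aut_beg[OF aut_G[OF g(1)] x'] beg_x' by (simp add: y_def)
  then have "g t \<in> TV" using beg_TD[OF y] by simp
  \<comment> \<open>Since \<open>y\<close> begins in \<open>TV\<close>, both \<open>t\<close> and
    \<open>g t\<close> lie in \<open>T\<close>. Hence \<open>g\<close> fixes \<open>t\<close> and is
    itself a generator, so undoing the move to \<open>y\<close> stays inside
    \<open>?H\<close>.\<close>
  then have "g t = t" using orbit_repr_unique[OF _ g(1)] t by (simp add: trans_verts_def)
  then have "g \<in> ?H" using gens_stab[OF t g(1)] by (simp add: generate.incl)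
  then have k: "h \<circ> inv_into UNIV g \<in> ?H" (is "?k \<in> _") using comp h inv by blast
  have "?k y = h (?h' x)" using inv_apply[OF g(1)] by (simp add: y_def)
  also have "\<dots> = x" using aut_bij[OF aut_G[OF HG[OF h]]] by (simp add: bij_is_surj surj_f_inv_f)
  finally have v: "v = ?k (dend \<Gamma> y)"
    using aut_dend[OF graph aut_G[OF HG[OF k]] TD_darts[OF y]] x(3) by simp
  show ?thesis
  \<comment> \<open>If \<open>y\<close> is inner, its end lies in \<open>TV\<close> and
    \<open>?k\<close> already serves. Otherwise \<open>a y\<close> brings the end into
    \<open>TV\<close>, and its inverse is absorbed into the translating element.\<close>
  proof (cases "y \<in> TI")
    case True
    then show ?thesis using v k dend_inner by blast
  next
    case False
    with y have y': "y \<in> TD - TI" by simp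
    have a: "a y \<in> ?H" using gens_return[OF y'] by (simp add: generate.incl)
    have "v = (?k \<circ> inv_into UNIV (a y)) (a y (dend \<Gamma> y))"
      using v inv_apply[OF HG[OF a]] by simp
    then show ?thesis using comp[OF k inv[OF a]] return_dend[OF y'] by blast
  qed
qed

lemma generate_if_graph_connected:
  assumes "graph_connected \<Gamma>"
  shows "G = generate (aut_group \<Gamma>) gens"
proof
  let ?H = "generate (aut_group \<Gamma>) gens"
  show "?H \<subseteq> G" by (rule generate_gens_subset)
  show "G \<subseteq> ?H"
  proof
    fix g assume g: "g \<in> G"
    obtain t where t: "t \<in> TV" using TV_nonempty by blast
    then have tv: "t \<in> verts \<Gamma>" by (simp add: trans_verts_def)
    have "(t, g t) \<in> (adj \<Gamma>)\<^sup>*"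
      using assms tv aut_vert[OF aut_G[OF g] tv] by (simp add: graph_connected_iff)
    \<comment> \<open>Induction along a path from \<open>t\<close> to \<open>g t\<close>: it starts
      in the translate of \<open>TV\<close> by \<open>id\<close>, and
      \<open>translate_adj_closed\<close> carries the property over each edge.\<close>
    then have "\<exists>h \<in> ?H. \<exists>s \<in> TV. g t = h s"
    proof induction
      case base
      have "t = id t" by simp
      then show ?case using t aut_subgroup_id[OF subgroup_generate_gens] by blast
    next
      case (step v w)
      then show ?case using translate_adj_closed by blast
    qed
    then obtain h s where h: "h \<in> ?H" and s: "s \<in> TV" "g t = h s" by blast
    have hG: "h \<in> G" using h generate_gens_subset by blast
    \<comment> \<open>This element sends \<open>t\<close> to \<open>s\<close>; both are in
      \<open>T\<close>, so \<open>s = t\<close> and \<open>?k\<close> stabilises \<open>t\<close>.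
      Thus \<open>g\<close> is recovered as \<open>h \<circ> ?k\<close>, with both factors in
      \<open>?H\<close>.\<close>
    let ?k = "inv_into UNIV h \<circ> g"
    have bij_h: "bij h" using aut_bij[OF aut_G[OF hG]] .
    have k: "?k \<in> G"
      using aut_subgroup_comp[OF subgroup_G aut_subgroup_inv[OF graph subgroup_G hG] g] .
    have kt: "?k t = s" using s(2) bij_h by (simp add: bij_is_inj)
    moreover have "?k t = t"
      using orbit_repr_unique[OF _ k, of t] t s(1) kt by (simp add: trans_verts_def)
    ultimately have "?k \<in> ?H" using gens_stab[OF t k] by (simp add: generate.incl)
    then have "h \<circ> ?k \<in> ?H" using aut_subgroup_comp[OF subgroup_generate_gens h] by blast
    moreover have "h \<circ> ?k = g" using bij_h by (auto simp: bij_is_surj surj_f_inv_f)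
    ultimately show "g \<in> ?H" by simp
  qed
qed

end

theorem theorem34:
  fixes \<Gamma> :: "'a graph" and G :: "('a \<Rightarrow> 'a) set" and T :: "'a set"
    and a :: "'a \<Rightarrow> ('a \<Rightarrow> 'a)"
  assumes "is_graph \<Gamma>"
    and "subgroup G (aut_group \<Gamma>)"
    and "connected_transversal \<Gamma> G T"
    and "\<And>x. x \<in> trans_darts \<Gamma> T - trans_inner_darts \<Gamma> T \<Longrightarrow>
           a x \<in> G \<and> a x (dinv \<Gamma> x) \<in> trans_darts \<Gamma> T"
  shows "graph_connected \<Gamma> \<longleftrightarrow>
    G = generate (aut_group \<Gamma>)
      ((\<Union>v \<in> trans_verts \<Gamma> T. stabilizer (aut_subgroup \<Gamma> G) (\<lambda>g x. g x) v) \<union>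
       {a x | x. x \<in> trans_darts \<Gamma> T - trans_inner_darts \<Gamma> T})"
proof -
  interpret connected_transversal_graph \<Gamma> G T a
    by (rule connected_transversal_graph.intro[OF assms])
  show ?thesis
    using graph_connected_if_generate generate_if_graph_connected unfolding gens_def by blast
qed

end
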